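(* Let $f : H \to H$ be an $\mathbb{R}$-linear mapping of the quaternion algebra, with coordinates $f^i_j \in \mathbb{R}$ ($0\le i,j\le 3$). Then there exist unique quaternions $a_0, a_1, a_2, a_3 \in H$ such that $$f = a_0\circ \overline{E} + a_1\circ \overline{E}_1 + a_2\circ \overline{E}_3 + a_3\circ \overline{I},$$ that is, $f(x) = a_0\,\overline{E}(x) + a_1\,\overline{E}_1(x) + a_2\,\overline{E}_3(x) + a_3\,\overline{I}(x)$ for all $x\in H$. Moreover, writing $a_m = a_m^0 + a_m^1 i + a_m^2 j + a_m^3 k$ with $a_m^n\in\mathbb{R}$ (upper indices are coordinate indices, not powers), the coefficients are given by $$\begin{aligned} a_0^0 &= \tfrac12(f_0^0 + f_1^1 - f_2^1 + f_3^0),\\ a_0^1 &= \tfrac12(f_0^1 - f_1^0 + f_2^0 + f_3^1),\\ a_0^2 &= \tfrac12(f_0^2 - f_1^3 + f_2^3 + f_3^2),\\ a_0^3 &= \tfrac12(f_0^3 + f_1^2 - f_2^2 + f_3^3),\\ a_1^0 &= \tfrac12(-f_1^0 - f_1^1 + f_2^0 + f_2^1 - f_3^0 + f_3^1 + f_3^2 + f_3^3),\\ a_1^1 &= \tfrac12(f_1^0 - f_1^1 - f_2^0 + f_2^1 - f_3^0 - f_3^1 - f_3^2 + f_3^3),\\ a_1^2 &= \tfrac12(-f_1^2 + f_1^3 + f_2^2 - f_2^3 - f_3^0 + f_3^1 - f_3^2 - f_3^3),\\ a_1^3 &= \tfrac12(-f_1^2 - f_1^3 + f_2^2 + f_2^3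 - f_3^0 - f_3^1 + f_3^2 - f_3^3),\\ a_2^0 &= \tfrac12(f_1^0 + f_1^2 - f_2^0 + f_2^1 - f_3^1 - f_3^2),\\ a_2^1 &= \tfrac12(f_1^1 + f_1^3 - f_2^0 - f_2^1 + f_3^0 - f_3^3),\\ a_2^2 &= \tfrac12(-f_1^0 + f_1^2 - f_2^2 - f_2^3 + f_3^0 + f_3^3),\\ a_2^3 &= \tfrac12(-f_1^1 + f_1^3 + f_2^2 - f_2^3 + f_3^1 - f_3^2),\\ a_3^0 &= \tfrac12(f_0^0 - f_1^2 - f_2^1 - f_3^3),\\ a_3^1 &= \tfrac12(f_0^1 - f_1^3 + f_2^0 + f_3^2),\\ a_3^2 &= \tfrac12(f_0^2 + f_1^0 + f_2^3 - f_3^1),\\ a_3^3 &= \tfrac12(f_0^3 + f_1^1 - f_2^2 + f_3^0). \end{aligned}$$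
   Context: $H$ is the algebra of quaternions over $\mathbb{R}$ with basis $\overline{e}_0=1$, $\overline{e}_1=i$, $\overline{e}_2=j$, $\overline{e}_3=k$ (with $i^2=j^2=k^2=-1$, $ij=k=-ji$, $jk=i=-kj$, $ki=j=-ik$). The coordinates $f^i_j$ of an $\mathbb{R}$-linear map $f:H\to H$ are the real numbers with $f(\overline{e}_j)=\sum_{i=0}^3 f^i_j\,\overline{e}_i$ (upper index = row, lower index = column of the matrix). For $x = x^0 + x^1 i + x^2 j + x^3 k$ with $x^n\in\mathbb{R}$, define the $\mathbb{R}$-linear maps $H\to H$: $$\overline{E}(x) = x,\qquad \overline{E}_1(x) = x^0 + x^2 i + x^3 j + x^1 k,$$ $$\overline{E}_3(x) = x^0 + x^2 i + x^1 j - x^3 k,\qquad \overline{I}(x) = x^0 - x^1 i - x^2 j - x^3 k.$$ For $a\in H$ and a map $g:H\to H$, $a\circ g$ denotes the map $x\mapsto a\,g(x)$ (left multiplication by $a$). *)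

theory Defs
  imports Complex_Main
begin

text \<open>\<open>Quat x0 x1 x2 x3\<close> stands for \<open>x0 + x1 i + x2 j + x3 k\<close>; see \<open>quat_eq_basis\<close>
  and \<open>quat_unit_mult\<close> below.\<close>

datatype quat = Quat (qx0: real) (qx1: real) (qx2: real) (qx3: real)

lemma quat_eq_iff:
  "x = y \<longleftrightarrow> qx0 x = qx0 y \<and> qx1 x = qx1 y \<and> qx2 x = qx2 y \<and> qx3 x = qx3 y"
  by (cases x; cases y) auto

instantiation quat :: real_algebra_1
begin

definition zero_quat :: quat where "0 = Quat 0 0 0 0"

definition one_quat :: quat where "1 = Quat 1 0 0 0"

definition plus_quat :: "quat \<Rightarrow> quat \<Rightarrow> quat" where
  "x + y = Quat (qx0 x + qx0 y) (qx1 x + qx1 y) (qx2 x + qx2 y) (qx3 x + qx3 y)"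

definition uminus_quat :: "quat \<Rightarrow> quat" where
  "- x = Quat (- qx0 x) (- qx1 x) (- qx2 x) (- qx3 x)"

definition minus_quat :: "quat \<Rightarrow> quat \<Rightarrow> quat" where
  "x - y = Quat (qx0 x - qx0 y) (qx1 x - qx1 y) (qx2 x - qx2 y) (qx3 x - qx3 y)"

definition scaleR_quat :: "real \<Rightarrow> quat \<Rightarrow> quat" where
  "r *\<^sub>R x = Quat (r * qx0 x) (r * qx1 x) (r * qx2 x) (r * qx3 x)"

definition times_quat :: "quat \<Rightarrow> quat \<Rightarrow> quat" where
  "x * y = Quat
     (qx0 x * qx0 y - qx1 x * qx1 y - qx2 x * qx2 y - qx3 x * qx3 y)
     (qx0 x * qx1 y + qx1 x * qx0 y + qx2 x * qx3 y - qx3 x * qx2 y)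
     (qx0 x * qx2 y - qx1 x * qx3 y + qx2 x * qx0 y + qx3 x * qx1 y)
     (qx0 x * qx3 y + qx1 x * qx2 y - qx2 x * qx1 y + qx3 x * qx0 y)"

instance
  by standard
    (simp_all add: quat_eq_iff zero_quat_def one_quat_def plus_quat_def uminus_quat_def
      minus_quat_def scaleR_quat_def times_quat_def algebra_simps)

end

definition quat_i :: quat where "quat_i = Quat 0 1 0 0"
definition quat_j :: quat where "quat_j = Quat 0 0 1 0"
definition quat_k :: quat where "quat_k = Quat 0 0 0 1"

lemma quat_unit_mult:
  "quat_i * quat_i = - 1" "quat_j * quat_j = - 1" "quat_k * quat_k = - 1"
  "quat_i * quat_j = quat_k" "quat_j * quat_i = - quat_k"
  "quat_j * quat_k = quat_i" "quat_k * quat_j = - quat_i"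
  "quat_k * quat_i = quat_j" "quat_i * quat_k = - quat_j"
  by (simp_all add: quat_eq_iff quat_i_def quat_j_def quat_k_def one_quat_def
      uminus_quat_def times_quat_def)

lemma quat_eq_basis:
  "Quat x0 x1 x2 x3 = x0 *\<^sub>R 1 + x1 *\<^sub>R quat_i + x2 *\<^sub>R quat_j + x3 *\<^sub>R quat_k"
  by (simp add: quat_eq_iff quat_i_def quat_j_def quat_k_def one_quat_def
      plus_quat_def scaleR_quat_def)

text \<open>Indices range over \<open>0, 1, 2, 3\<close>; the values at larger indices are irrelevant.\<close>

definition qbasis :: "nat \<Rightarrow> quat" where
  "qbasis n = (if n = 0 then 1 else if n = 1 then quat_i else if n = 2 then quat_j else quat_k)"

definition qcoord :: "quat \<Rightarrow> nat \<Rightarrow> real" where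
  "qcoord x n = (if n = 0 then qx0 x else if n = 1 then qx1 x else if n = 2 then qx2 x else qx3 x)"

text \<open>\<open>lin_coord f i j\<close> is \<open>f\<^sup>i\<^sub>j\<close>: row (upper) index first, column (lower) index second.\<close>

definition lin_coord :: "(quat \<Rightarrow> quat) \<Rightarrow> nat \<Rightarrow> nat \<Rightarrow> real" where
  "lin_coord f i j = qcoord (f (qbasis j)) i"

lemma qcoord_unique:
  "x = (\<Sum>n\<le>3. c n *\<^sub>R qbasis n) \<longleftrightarrow> (\<forall>n\<le>3. c n = qcoord x n)"
proof -
  have "{..3::nat} = {0, 1, 2, 3}" by auto
  then have s: "(\<Sum>n\<le>3. c n *\<^sub>R qbasis n) = Quat (c 0) (c 1) (c 2) (c 3)"
    by (simp add: quat_eq_basis qbasis_def add.assoc)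
  have "(\<forall>n\<le>3. c n = qcoord x n) \<longleftrightarrow>
      c 0 = qcoord x 0 \<and> c 1 = qcoord x 1 \<and> c 2 = qcoord x 2 \<and> c 3 = qcoord x 3"
    by (auto simp: le_Suc_eq numeral_eq_Suc)
  then show ?thesis
    unfolding s by (auto simp: quat_eq_iff qcoord_def)
qed

lemma lin_coord_unique:
  "(\<forall>j\<le>3. f (qbasis j) = (\<Sum>i\<le>3. F i j *\<^sub>R qbasis i)) \<longleftrightarrow>
   (\<forall>j\<le>3. \<forall>i\<le>3. F i j = lin_coord f i j)"
  by (simp add: qcoord_unique lin_coord_def)

definition qE :: "quat \<Rightarrow> quat" where
  "qE x = x"

definition qE1 :: "quat \<Rightarrow> quat" where
  "qE1 x = Quat (qx0 x) (qx2 x) (qx3 x) (qx1 x)"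

definition qE3 :: "quat \<Rightarrow> quat" where
  "qE3 x = Quat (qx0 x) (qx2 x) (qx1 x) (- qx3 x)"

definition qI :: "quat \<Rightarrow> quat" where
  "qI x = Quat (qx0 x) (- qx1 x) (- qx2 x) (- qx3 x)"

lemma linear_qE: "linear qE" and linear_qE1: "linear qE1"
  and linear_qE3: "linear qE3" and linear_qI: "linear qI"
  by (simp_all add: linear_iff quat_eq_iff qE_def qE1_def qE3_def qI_def
      plus_quat_def scaleR_quat_def)

definition lmult_comp :: "quat \<Rightarrow> (quat \<Rightarrow> quat) \<Rightarrow> quat \<Rightarrow> quat" where
  "lmult_comp a g = (\<lambda>x. a * g x)"

definition quat_expansion :: "quat \<Rightarrow> quat \<Rightarrow> quat \<Rightarrow> quat \<Rightarrow> quat \<Rightarrow> quat" where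
  "quat_expansion a0 a1 a2 a3 =
     (\<lambda>x. lmult_comp a0 qE x + lmult_comp a1 qE1 x + lmult_comp a2 qE3 x + lmult_comp a3 qI x)"

end

(* A linear map is determined by its values on the basis 1, i, j, k. Comparing coordinates of
   f(1) = a0 + a1 + a2 + a3,  f(i) = a0 i + a1 k + a2 j - a3 i,
   f(j) = a0 j + a1 i + a2 i - a3 j,  f(k) = a0 k + a1 j - a2 k - a3 k
   gives a system of 16 real linear equations in the 16 coordinates of a0, ..., a3, and this system
   is uniquely solvable. *)
theory Submission
  imports Defs
begin

lemma linear_quat_eq_iff:
  fixes f g :: "quat \<Rightarrow> 'a::real_vector"
  assumes "linear f" "linear g"
  shows "f = g \<longleftrightarrow>
    f 1 = g 1 \<and> f quat_i = g quat_i \<and> f quat_j = g quat_j \<and> f quat_k = g quat_k"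
proof -
  have "f x = g x"
    if "f 1 = g 1" "f quat_i = g quat_i" "f quat_j = g quat_j" "f quat_k = g quat_k" for x
    using that
    by (cases x) (simp add: quat_eq_basis linear_add linear_scale assms)
  then show ?thesis by auto
qed

text \<open>Allows the expansion to be compared with \<open>f\<close> on the four units
  only.\<close>

lemma linear_quat_expansion: "linear (quat_expansion a0 a1 a2 a3)"
  unfolding linear_iff quat_expansion_def lmult_comp_def
  by (simp add: linear_add linear_scale linear_qE linear_qE1 linear_qE3 linear_qI algebra_simps)

text \<open>\<open>qE1\<close> permutes the units cyclically (i to k, k to j, j to i);
  \<open>qE3\<close> swaps i and j and negates k; \<open>qI\<close> negates all three.\<close>

lemma quat_expansion_basis:
  "quat_expansion a0 a1 a2 a3 1 = a0 + a1 + a2 + a3"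
  "quat_expansion a0 a1 a2 a3 quat_i = a0 * quat_i + a1 * quat_k + a2 * quat_j - a3 * quat_i"
  "quat_expansion a0 a1 a2 a3 quat_j = a0 * quat_j + a1 * quat_i + a2 * quat_i - a3 * quat_j"
  "quat_expansion a0 a1 a2 a3 quat_k = a0 * quat_k + a1 * quat_j - a2 * quat_k - a3 * quat_k"
  by (simp_all add: quat_expansion_def lmult_comp_def qE_def qE1_def qE3_def qI_def quat_i_def
      quat_j_def quat_k_def one_quat_def times_quat_def plus_quat_def minus_quat_def)

text \<open>The system can be solved by right multiplication with units. With d = a0 - a3, the
  values at i and k give a1 + d j - a2 i = -f(i) k and a1 + d i - a2 i = -f(k) j; subtracting
  isolates d (j - i), hence d. The value at j then gives a1 + a2, and removing the now known a1 - a2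
  i leaves a2 (1 + i), hence a2 and a1. Finally f(1) gives a0 + a3, which with d determines a0 and
  a3.\<close>

lemma eq_quat_expansion_iff:
  fixes f :: "quat \<Rightarrow> quat"
  assumes "linear f"
  defines "F \<equiv> lin_coord f"
  shows
    "f = quat_expansion a0 a1 a2 a3 \<longleftrightarrow>
       a0 = Quat
         (1/2 * (F 0 0 + F 1 1 - F 1 2 + F 0 3))
         (1/2 * (F 1 0 - F 0 1 + F 0 2 + F 1 3))
         (1/2 * (F 2 0 - F 3 1 + F 3 2 + F 2 3))
         (1/2 * (F 3 0 + F 2 1 - F 2 2 + F 3 3)) \<and>
       a1 = Quat
         (1/2 * (- F 0 1 - F 1 1 + F 0 2 + F 1 2 - F 0 3 + F 1 3 + F 2 3 + F 3 3))
         (1/2 * (F 0 1 - F 1 1 - F 0 2 + F 1 2 - F 0 3 - F 1 3 - F 2 3 + F 3 3))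
         (1/2 * (- F 2 1 + F 3 1 + F 2 2 - F 3 2 - F 0 3 + F 1 3 - F 2 3 - F 3 3))
         (1/2 * (- F 2 1 - F 3 1 + F 2 2 + F 3 2 - F 0 3 - F 1 3 + F 2 3 - F 3 3)) \<and>
       a2 = Quat
         (1/2 * (F 0 1 + F 2 1 - F 0 2 + F 1 2 - F 1 3 - F 2 3))
         (1/2 * (F 1 1 + F 3 1 - F 0 2 - F 1 2 + F 0 3 - F 3 3))
         (1/2 * (- F 0 1 + F 2 1 - F 2 2 - F 3 2 + F 0 3 + F 3 3))
         (1/2 * (- F 1 1 + F 3 1 + F 2 2 - F 3 2 + F 1 3 - F 2 3)) \<and>
       a3 = Quat
         (1/2 * (F 0 0 - F 2 1 - F 1 2 - F 3 3))
         (1/2 * (F 1 0 - F 3 1 + F 0 2 + F 2 3))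
         (1/2 * (F 2 0 + F 0 1 + F 3 2 - F 1 3))
         (1/2 * (F 3 0 + F 1 1 - F 2 2 + F 0 3))"
proof -
  have "f = quat_expansion a0 a1 a2 a3 \<longleftrightarrow>
      f 1 = a0 + a1 + a2 + a3 \<and>
      f quat_i = a0 * quat_i + a1 * quat_k + a2 * quat_j - a3 * quat_i \<and>
      f quat_j = a0 * quat_j + a1 * quat_i + a2 * quat_i - a3 * quat_j \<and>
      f quat_k = a0 * quat_k + a1 * quat_j - a2 * quat_k - a3 * quat_k"
    by (simp add: linear_quat_eq_iff[OF assms(1) linear_quat_expansion] quat_expansion_basis)
  then show ?thesis
    \<comment> \<open>Taking components turns both sides into real linear equations; each direction
      is then linear arithmetic: solving the system one way, checking the solution the
      other.\<close>
    by (simp add: F_def lin_coord_def qcoord_def qbasis_def quat_eq_iff quat_i_def quat_j_def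
        quat_k_def plus_quat_def minus_quat_def times_quat_def)
      (safe; argo)
qed

theorem theorem12p1:
  fixes f :: "quat \<Rightarrow> quat"
  assumes "linear f"
  shows
    "(\<exists>!(a :: quat \<times> quat \<times> quat \<times> quat).
        case a of (a0, a1, a2, a3) \<Rightarrow> f = quat_expansion a0 a1 a2 a3) \<and>
     (\<forall>a0 a1 a2 a3. f = quat_expansion a0 a1 a2 a3 \<longrightarrow>
       (let F = lin_coord f in
          qcoord a0 0 = 1/2 * (F 0 0 + F 1 1 - F 1 2 + F 0 3) \<and>
          qcoord a0 1 = 1/2 * (F 1 0 - F 0 1 + F 0 2 + F 1 3) \<and>
          qcoord a0 2 = 1/2 * (F 2 0 - F 3 1 + F 3 2 + F 2 3) \<and>
          qcoord a0 3 = 1/2 * (F 3 0 + F 2 1 - F 2 2 + F 3 3) \<and>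
          qcoord a1 0 = 1/2 * (- F 0 1 - F 1 1 + F 0 2 + F 1 2 - F 0 3 + F 1 3 + F 2 3 + F 3 3) \<and>
          qcoord a1 1 = 1/2 * (F 0 1 - F 1 1 - F 0 2 + F 1 2 - F 0 3 - F 1 3 - F 2 3 + F 3 3) \<and>
          qcoord a1 2 = 1/2 * (- F 2 1 + F 3 1 + F 2 2 - F 3 2 - F 0 3 + F 1 3 - F 2 3 - F 3 3) \<and>
          qcoord a1 3 = 1/2 * (- F 2 1 - F 3 1 + F 2 2 + F 3 2 - F 0 3 - F 1 3 + F 2 3 - F 3 3) \<and>
          qcoord a2 0 = 1/2 * (F 0 1 + F 2 1 - F 0 2 + F 1 2 - F 1 3 - F 2 3) \<and>
          qcoord a2 1 = 1/2 * (F 1 1 + F 3 1 - F 0 2 - F 1 2 + F 0 3 - F 3 3) \<and>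
          qcoord a2 2 = 1/2 * (- F 0 1 + F 2 1 - F 2 2 - F 3 2 + F 0 3 + F 3 3) \<and>
          qcoord a2 3 = 1/2 * (- F 1 1 + F 3 1 + F 2 2 - F 3 2 + F 1 3 - F 2 3) \<and>
          qcoord a3 0 = 1/2 * (F 0 0 - F 2 1 - F 1 2 - F 3 3) \<and>
          qcoord a3 1 = 1/2 * (F 1 0 - F 3 1 + F 0 2 + F 2 3) \<and>
          qcoord a3 2 = 1/2 * (F 2 0 + F 0 1 + F 3 2 - F 1 3) \<and>
          qcoord a3 3 = 1/2 * (F 3 0 + F 1 1 - F 2 2 + F 0 3)))"
  \<comment> \<open>Since the lemma is an equivalence, rewriting with it replaces the condition on
    the tuple by equality with one explicit tuple, which yields existence, uniqueness and the
    formulas at once.\<close>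
  unfolding eq_quat_expansion_iff[OF assms] Let_def
  by (auto simp: qcoord_def)

end
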